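(* A binary function is linear if and only if it has no minor isomorphic to any of: (i) $f_\alpha$, where $\alpha\in\mathbb{R}\setminus\{0,1\}$; (ii) $g\colon 2^{\{a,b\}}\to\mathbb{R}$ with $g(X)=1$ if $|X|\in\{0,1\}$ and $g(X)=-1$ if $|X|=2$; (iii) $f_{\mathcal{U}_{2,4}}\colon 2^{\{a,b,c,d\}}\to\mathbb{R}$ with $f_{\mathcal{U}_{2,4}}(X)=0$ if $|X|\in\{1,2\}$, $f_{\mathcal{U}_{2,4}}(X)=1$ if $|X|\in\{0,3\}$, and $f_{\mathcal{U}_{2,4}}(X)=-1$ if $|X|=4$.
   Context: A binary function on a finite ground set $E$ is a function $f\colon 2^E\to\mathbb{R}$ with $f(\emptyset)=1$. A binary function $f$ is linear if it is $\{0,1\}$-valued and for all $X,Y\subseteq E$, $f(X)=f(Y)=1$ implies $f(X\triangle Y)=1$. For $X\subseteq E$, the contraction $f/X\colon 2^{E\setminus X}\to\mathbb{R}$ is $f/X(Y)=f(Y)$, and the deletion $f\setminus X\colon 2^{E\setminus X}\to\mathbb{R}$ is $f\setminus X(Y)=\frac{\sum_{Z\subseteq X} f(Y\cup Z)}{\sum_{Z\subseteq X} f(Z)}$, well defined exactly when the denominator is nonzero. A minor of $f$ is a well-defined binary function $(f/X)\setminus Y$ for disjoint $X,Y\subseteq E$. Two binary functions $f$ on $E$ and $f'$ on $E'$ are isomorphic if there is a bijection $\phi\colon E\to E'$ with $f(X)=f'(\phi(X))$ for all $X\subseteq E$. For $\alpha\in\mathbb{R}$, $f_\alpha$ denotes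 the binary function on a one-element ground set $E$ with $f_\alpha(E)=\alpha$. *)

theory Defs
  imports Complex_Main "HOL-Library.FuncSet"
begin

text \<open>
  A binary function on \<open>E\<close> is a pair of a finite set \<open>E\<close> and a function \<open>f\<close> on all sets of the
  ambient type; only the values of \<open>f\<close> on \<open>Pow E\<close> are significant.
\<close>

definition binary_function :: "'a set \<Rightarrow> ('a set \<Rightarrow> real) \<Rightarrow> bool" where
  "binary_function E f \<longleftrightarrow> finite E \<and> f {} = 1"

definition linear_bf :: "'a set \<Rightarrow> ('a set \<Rightarrow> real) \<Rightarrow> bool" where
  "linear_bf E f \<longleftrightarrow>
     (\<forall>X. X \<subseteq> E \<longrightarrow> f X \<in> {0, 1}) \<and>
     (\<forall>X Y. X \<subseteq> E \<longrightarrow> Y \<subseteq> E \<longrightarrow> f X = 1 \<longrightarrow> f Y = 1 \<longrightarrow> f (sym_diff X Y) = 1)"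

definition contraction :: "'a set \<Rightarrow> ('a set \<Rightarrow> real) \<Rightarrow> 'a set \<Rightarrow> ('a set \<Rightarrow> real)" where
  "contraction E f X = restrict f (Pow (E - X))"

definition deletion_defined :: "('a set \<Rightarrow> real) \<Rightarrow> 'a set \<Rightarrow> bool" where
  "deletion_defined f X \<longleftrightarrow> (\<Sum>Z\<in>Pow X. f Z) \<noteq> 0"

definition deletion :: "'a set \<Rightarrow> ('a set \<Rightarrow> real) \<Rightarrow> 'a set \<Rightarrow> ('a set \<Rightarrow> real)" where
  "deletion E f X =
     restrict (\<lambda>Y. (\<Sum>Z\<in>Pow X. f (Y \<union> Z)) / (\<Sum>Z\<in>Pow X. f Z)) (Pow (E - X))"

definition is_minor ::
  "'a set \<Rightarrow> ('a set \<Rightarrow> real) \<Rightarrow> 'a set \<Rightarrow> ('a set \<Rightarrow> real) \<Rightarrow> bool" where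
  "is_minor E' f' E f \<longleftrightarrow>
     (\<exists>X Y. X \<subseteq> E \<and> Y \<subseteq> E \<and> X \<inter> Y = {} \<and>
        deletion_defined (contraction E f X) Y \<and>
        E' = (E - X) - Y \<and>
        f' = deletion (E - X) (contraction E f X) Y)"

definition bf_isomorphic ::
  "'a set \<Rightarrow> ('a set \<Rightarrow> real) \<Rightarrow> 'b set \<Rightarrow> ('b set \<Rightarrow> real) \<Rightarrow> bool" where
  "bf_isomorphic E f E' f' \<longleftrightarrow>
     (\<exists>\<phi>. bij_betw \<phi> E E' \<and> (\<forall>X. X \<subseteq> E \<longrightarrow> f X = f' (\<phi> ` X)))"

text \<open>
  The excluded minors live on the ground sets \<open>{0}\<close>, \<open>{0, 1}\<close> and \<open>{0, 1, 2, 3}\<close> of natural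
  numbers; the names of the elements are irrelevant up to isomorphism.
\<close>

definition f_alpha :: "real \<Rightarrow> nat set \<Rightarrow> real" where
  "f_alpha \<alpha> X = (if X = {} then 1 else \<alpha>)"

definition g_fun :: "nat set \<Rightarrow> real" where
  "g_fun X = (if card X \<in> {0, 1} then 1 else -1)"

definition f_U24 :: "nat set \<Rightarrow> real" where
  "f_U24 X = (if card X \<in> {1, 2} then 0 else if card X \<in> {0, 3} then 1 else -1)"

lemma binary_function_minor:
  assumes "binary_function E f" "is_minor E' f' E f"
  shows "binary_function E' f'"
  using assms
  by (auto simp: binary_function_def is_minor_def deletion_def deletion_defined_def)

end

theory Submission
  imports Defs
begin

text \<open>
  A linear \<open>f\<close> is the indicator of a binary vector space, and the sum in the numerator of a deletion
  then runs over the empty set or over a coset of the space counted by the denominator; hence all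
  minors take values in \<open>{0, 1}\<close>, unlike the excluded ones at the full ground set.

  Conversely, let \<open>g\<close> be a minor-minimal nonlinear minor. Linearity of its contractions means that only
  sets covering the ground set \<open>E\<close> can violate linearity. If \<open>|E| \<ge> 3\<close> and \<open>g {e} = 1\<close>, then \<open>g / e\<close>
  and the deletion of \<open>e\<close> are vector spaces that differ at most in \<open>E - {e}\<close>, which forces
  linearity. Otherwise the deletion of \<open>e\<close> is \<open>V \<mapsto> g V + g (V \<union> {e})\<close>; its linearity
  yields \<open>g E \<in> {-1, 0, 1}\<close>. The values \<open>0\<close> and \<open>1\<close> are excluded by shrinking a violating pair of
  sets two elements at a time, and the value \<open>-1\<close> leaves only \<open>U\<^sub>2\<^sub>,\<^sub>4\<close>.
\<close>

section \<open>Linear functions and the values of their deletions\<close>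

lemma linear_bf_cong:
  assumes "linear_bf E f" "\<And>X. X \<subseteq> E \<Longrightarrow> f X = g X"
  shows "linear_bf E g"
  unfolding linear_bf_def
proof (intro conjI allI impI)
  fix X assume "X \<subseteq> E"
  then show "g X \<in> {0, 1}" using assms unfolding linear_bf_def by metis
next
  fix X Y assume XY: "X \<subseteq> E" "Y \<subseteq> E" "g X = 1" "g Y = 1"
  then have "sym_diff X Y \<subseteq> E" by auto
  then show "g (sym_diff X Y) = 1"
    using XY assms unfolding linear_bf_def by metis
qed

lemma linear_bf_value: "linear_bf E f \<Longrightarrow> X \<subseteq> E \<Longrightarrow> f X \<in> {0, 1}"
  by (auto simp: linear_bf_def)

text \<open>If some \<open>V \<union> Z0\<close> has value 1, translation by it preserves
  \<open>f\<close> and sends \<open>V \<union> Z\<close> to \<open>sym_diff Z Z0\<close>, so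
  numerator and denominator agree. Otherwise the numerator vanishes.\<close>

lemma linear_bf_deletion_value:
  assumes lin: "linear_bf E f" and "finite E" "V \<subseteq> E" "Y \<subseteq> E" "V \<inter> Y = {}"
    and nz: "(\<Sum>Z\<in>Pow Y. f Z) \<noteq> 0"
  shows "(\<Sum>Z\<in>Pow Y. f (V \<union> Z)) / (\<Sum>Z\<in>Pow Y. f Z) \<in> {0, 1}"
proof (cases "\<exists>Z0\<in>Pow Y. f (V \<union> Z0) = 1")
  case False
  have "f (V \<union> Z) = 0" if "Z \<in> Pow Y" for Z
  proof -
    have "V \<union> Z \<subseteq> E" using that assms by auto
    then have "f (V \<union> Z) \<in> {0, 1}" using lin unfolding linear_bf_def by blast
    then show ?thesis using False that by auto
  qed
  then show ?thesis by simp
next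
  case True
  then obtain Z0 where Z0: "Z0 \<subseteq> Y" "f (V \<union> Z0) = 1" by auto
  have eq1: "f A = f (sym_diff A (V \<union> Z0))" if "A \<subseteq> E" for A
  proof -
    have sub: "V \<union> Z0 \<subseteq> E" "sym_diff A (V \<union> Z0) \<subseteq> E" using that assms Z0 by auto
    have inv: "sym_diff (sym_diff A (V \<union> Z0)) (V \<union> Z0) = A" by auto
    have "f A = 1 \<Longrightarrow> f (sym_diff A (V \<union> Z0)) = 1"
      using lin sub that Z0 unfolding linear_bf_def by blast
    moreover have "f (sym_diff A (V \<union> Z0)) = 1 \<Longrightarrow> f A = 1"
      using lin sub that Z0 inv unfolding linear_bf_def by metis
    moreover have "f A \<in> {0, 1}" "f (sym_diff A (V \<union> Z0)) \<in> {0, 1}"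
      using lin sub that unfolding linear_bf_def by blast+
    ultimately show ?thesis by auto
  qed
  have "(\<Sum>Z\<in>Pow Y. f (V \<union> Z)) = (\<Sum>Z\<in>Pow Y. f Z)"
  proof (rule sum.reindex_bij_witness[where i = "\<lambda>Z. sym_diff Z Z0" and j = "\<lambda>Z. sym_diff Z Z0"])
    fix Z assume Z: "Z \<in> Pow Y"
    have "V \<union> Z \<subseteq> E" using Z assms by auto
    moreover have "sym_diff (V \<union> Z) (V \<union> Z0) = sym_diff Z Z0" using Z Z0 assms by auto
    ultimately show "f (sym_diff Z Z0) = f (V \<union> Z)" using eq1 by metis
  qed (use Z0 in auto)
  then show ?thesis using nz by simp
qed

section \<open>Functions whose single-element contractions and deletions are linear\<close>

text \<open>
  The condition \<open>g {e} \<noteq> -1\<close> says that the deletion of \<open>e\<close> is well defined.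
\<close>

locale almost_linear =
  fixes E :: "'a set" and g :: "'a set \<Rightarrow> real"
  assumes finite_E: "finite E"
    and empty: "g {} = 1"
    and contract: "e \<in> E \<Longrightarrow> linear_bf (E - {e}) g"
    and delete: "e \<in> E \<Longrightarrow> g {e} \<noteq> -1 \<Longrightarrow>
      linear_bf (E - {e}) (\<lambda>V. (g V + g (insert e V)) / (1 + g {e}))"
begin

lemma proper_value: "X \<subseteq> E \<Longrightarrow> e \<in> E \<Longrightarrow> e \<notin> X \<Longrightarrow> g X \<in> {0, 1}"
  using contract[of e] unfolding linear_bf_def by blast

lemma proper_closed:
  assumes "g X = 1" "g Y = 1" "X \<subseteq> E" "Y \<subseteq> E" "e \<in> E" "e \<notin> X" "e \<notin> Y" "Z = sym_diff X Y"
  shows "g Z = 1"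
proof -
  have "X \<subseteq> E - {e}" "Y \<subseteq> E - {e}" using assms by auto
  then show ?thesis using contract[of e] assms unfolding linear_bf_def by blast
qed

text \<open>A violating pair that misses a common element \<open>e\<close> would already violate
  linearity of the contraction of \<open>e\<close>.\<close>

lemma nonlinear_witness:
  assumes "\<not> linear_bf E g" "g E \<in> {0, 1}"
  obtains X Y where "X \<union> Y = E" "g X = 1" "g Y = 1" "g (sym_diff X Y) \<noteq> 1"
proof -
  have "g X \<in> {0, 1}" if "X \<subseteq> E" for X
  proof (cases "X = E")
    case False
    then obtain e where "e \<in> E" "e \<notin> X" using \<open>X \<subseteq> E\<close> by auto
    then show ?thesis using \<open>X \<subseteq> E\<close> proper_value by simp
  qed (use assms in simp)
  then obtain X Y where XY: "X \<subseteq> E" "Y \<subseteq> E" "g X = 1" "g Y = 1" "g (sym_diff X Y) \<noteq> 1"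
    using assms(1) unfolding linear_bf_def by blast
  have "X \<union> Y = E"
  proof (rule ccontr)
    assume "X \<union> Y \<noteq> E"
    then obtain e where "e \<in> E" "e \<notin> X" "e \<notin> Y" using XY by auto
    then show False using proper_closed[OF XY(3,4,1,2)] XY(5) by blast
  qed
  then show ?thesis using that XY by blast
qed

section \<open>Elements of value 1\<close>

text \<open>Translation by \<open>{e}\<close> makes \<open>e\<close> irrelevant except possibly
  between \<open>T\<close> and \<open>E\<close>. If \<open>g E = g T\<close>, then \<open>g\<close>
  is pulled back from the contraction of \<open>e\<close>. If not, deleting another element puts
  \<open>g E\<close> into {0, 1}, so that \<open>d T\<close> is 1/2, which is impossible.\<close>

lemma loop_imp_linear:
  assumes e: "e \<in> E" "g {e} = 1" and card: "card E \<ge> 3"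
  shows "linear_bf E g"
proof -
  define T where "T = E - {e}"
  define d where "d V = (g V + g (insert e V)) / 2" for V
  have linT: "linear_bf T g" using contract e T_def by simp
  have lind: "linear_bf T d" using delete[of e] e unfolding T_def d_def by simp
  have E: "E = insert e T" "e \<notin> T" using e T_def by auto
  have cT: "card T \<ge> 2" using card e finite_E T_def by simp
  have ins: "g (insert e Y) = g Y" if Y: "Y \<subset> T" for Y
  proof -
    \<comment> \<open>The element \<open>x\<close> keeps \<open>Y\<close>, \<open>{e}\<close> and
      \<open>insert e Y\<close> inside one linear contraction.\<close>
    obtain x where x: "x \<in> T" "x \<notin> Y" using Y by blast
    have xE: "x \<in> E" "x \<noteq> e" "Y \<subseteq> E" "e \<notin> Y" using x Y E by auto
    have "g Y = 1 \<Longrightarrow> g (insert e Y) = 1"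
      using proper_closed[of Y "{e}" x "insert e Y"] xE x e by auto
    moreover have "g (insert e Y) = 1 \<Longrightarrow> g Y = 1"
      using proper_closed[of "insert e Y" "{e}" x Y] xE x e by auto
    moreover have "g Y \<in> {0, 1}" "g (insert e Y) \<in> {0, 1}"
      using proper_value[of _ x] xE x e by auto
    ultimately show ?thesis by auto
  qed
  then have dg: "d Y = g Y" if "Y \<subset> T" for Y using that by (simp add: d_def)
  show ?thesis
  proof (cases "g E = g T")
    case True
    have red: "g X = g (X - {e})" if "X \<subseteq> E" for X
    proof (cases "e \<in> X")
      case eX: True
      show ?thesis
      proof (cases "X = E")
        case False
        then have "X - {e} \<subset> T" using that eX T_def by auto
        from ins[OF this] show ?thesis using eX by (simp add: insert_absorb)
      qed (use True T_def in simp)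
    qed simp
    show ?thesis unfolding linear_bf_def
    proof (intro conjI allI impI)
      fix X assume X: "X \<subseteq> E"
      then have "X - {e} \<subseteq> T" using T_def by auto
      then show "g X \<in> {0, 1}" using red[OF X] linT unfolding linear_bf_def by simp
    next
      fix X Y assume XY: "X \<subseteq> E" "Y \<subseteq> E" "g X = 1" "g Y = 1"
      have "sym_diff X Y \<subseteq> E" using XY by auto
      moreover have "sym_diff X Y - {e} = sym_diff (X - {e}) (Y - {e})" by auto
      moreover have "g (X - {e}) = 1" "g (Y - {e}) = 1" using red XY by auto
      moreover have "X - {e} \<subseteq> T" "Y - {e} \<subseteq> T" using XY T_def by auto
      ultimately show "g (sym_diff X Y) = 1"
        using red linT unfolding linear_bf_def by metis
    qed
  next
    case False
    have dT: "d T = (g T + g E) / 2" by (simp add: d_def E(1))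
    have vals: "g T \<in> {0, 1}" "d T \<in> {0, 1}"
      using linT lind unfolding linear_bf_def by blast+
    \<comment> \<open>The contraction and the deletion of \<open>e\<close> are two linear spaces that differ
      only in \<open>T\<close>, so they have one and two elements.\<close>
    have zero: "g Y = 0" if Y: "Y \<subset> T" "Y \<noteq> {}" for Y
    proof (rule ccontr)
      assume "g Y \<noteq> 0"
      then have gY: "g Y = 1" using linT Y unfolding linear_bf_def by blast
      then have dY: "d Y = 1" using dg Y by simp
      \<comment> \<open>Translation by \<open>Y\<close> ties the values at \<open>T\<close> to those
        at \<open>T - Y\<close>, where \<open>g\<close> and \<open>d\<close> agree; so they would
        agree at \<open>T\<close> too.\<close>
      have TY: "T - Y \<subset> T" using Y by auto
      have sd: "sym_diff T Y = T - Y" "sym_diff Y (T - Y) = T" using Y by auto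
      have "g T = 1 \<Longrightarrow> g (T - Y) = 1" "d T = 1 \<Longrightarrow> d (T - Y) = 1"
        using linT lind gY dY Y sd unfolding linear_bf_def
        by (metis order_refl psubset_imp_subset)+
      moreover have "g (T - Y) = 1 \<Longrightarrow> g T = 1" "d (T - Y) = 1 \<Longrightarrow> d T = 1"
        using linT lind gY dY Y sd TY unfolding linear_bf_def
        by (metis psubset_imp_subset)+
      ultimately have "g T = 1 \<longleftrightarrow> d T = 1" using dg[OF TY] by metis
      then have "g T = d T" using vals by auto
      then show False using False dT by (simp add: field_simps)
    qed
    \<comment> \<open>Since \<open>g {b}\<close> and \<open>g (E - {b})\<close> vanish, the deletion
      of \<open>b\<close> has value \<open>g E\<close> at its full ground set.\<close>
    obtain b where b: "b \<in> T" using cT by fastforce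
    have "T \<noteq> {b}" using cT by auto
    then have "T - {b} \<noteq> {}" using b by auto
    have pb: "{b} \<subset> T" "T - {b} \<subset> T" using b \<open>T \<noteq> {b}\<close> by auto
    have gb: "g {b} = 0" "g (T - {b}) = 0" using zero pb \<open>T - {b} \<noteq> {}\<close> by auto
    have bE: "b \<in> E" "b \<noteq> e" using b E by auto
    have "E - {b} = insert e (T - {b})" using E bE by auto
    then have gEb: "g (E - {b}) = 0" using ins[OF pb(2)] gb by simp
    have "insert b (E - {b}) = E" using bE by auto
    then have "g E \<in> {0, 1}"
      using linear_bf_value[OF delete[OF bE(1)] order_refl] gb gEb by simp
    then have False using vals dT False by auto
    then show ?thesis ..
  qed
qed

end

section \<open>At least three elements, all of value 0\<close>

locale loopless_almost_linear = almost_linear +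
  assumes card_E: "card E \<ge> 3"
    and loopless: "e \<in> E \<Longrightarrow> g {e} = 0"
begin

text \<open>The deletion of \<open>e\<close>: its denominator \<open>1 + g {e}\<close> is 1
  here.\<close>

definition D where "D e V = g V + g (insert e V)"

lemma D_value: "e \<in> E \<Longrightarrow> V \<subseteq> E \<Longrightarrow> e \<notin> V \<Longrightarrow> D e V \<in> {0, 1}"
  using delete[of e] loopless[of e] unfolding linear_bf_def D_def
  by (simp add: subset_Diff_insert)

lemma D_closed:
  assumes "D e X = 1" "D e Y = 1" "e \<in> E" "X \<subseteq> E" "Y \<subseteq> E" "e \<notin> X" "e \<notin> Y" "Z = sym_diff X Y"
  shows "D e Z = 1"
proof -
  have "X \<subseteq> E - {e}" "Y \<subseteq> E - {e}" using assms by auto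
  then show ?thesis
    using delete[of e] loopless[of e] assms unfolding linear_bf_def D_def by simp
qed

text \<open>The sum \<open>g (X - {e}) + 1\<close> is a deletion value, hence at most 1. Thus two
  sets of value 1 never differ in exactly one element.\<close>

lemma D_remove:
  assumes "g X = 1" "X \<subseteq> E" "e \<in> X"
  shows "D e (X - {e}) = 1" "g (X - {e}) = 0"
proof -
  have "D e (X - {e}) \<in> {0, 1}" "g (X - {e}) \<in> {0, 1}"
    using D_value[of e "X - {e}"] proper_value[of "X - {e}" e] assms by auto
  moreover have "D e (X - {e}) = g (X - {e}) + 1"
    using assms by (simp add: D_def insert_absorb)
  ultimately show "D e (X - {e}) = 1" "g (X - {e}) = 0" by auto
qed

text \<open>The element \<open>x\<close> makes \<open>insert e X\<close> proper, so its value cannot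
  be negative and cancel \<open>g X\<close>.\<close>

lemma D_add:
  assumes "g X = 1" "X \<subseteq> E" "e \<in> E" "e \<notin> X" "x \<in> E" "x \<notin> insert e X"
  shows "D e X = 1"
proof -
  have "D e X \<in> {0, 1}" "g (insert e X) \<in> {0, 1}"
    using D_value[of e X] proper_value[of "insert e X" x] assms by auto
  then show ?thesis using assms by (auto simp: D_def)
qed

text \<open>Below the top, \<open>g\<close> is the even-weight space: an even set is a pair added to
  a smaller even set, and an odd set is one element away from an even one, so
  \<open>D_remove\<close> rules out value 1.\<close>

lemma value_if_pairs:
  assumes pairs: "\<And>a b. a \<in> E \<Longrightarrow> b \<in> E \<Longrightarrow> a \<noteq> b \<Longrightarrow> g {a, b} = 1"
    and "X \<subset> E"
  shows "g X = (if even (card X) then 1 else 0)"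
proof -
  have "finite X" using assms finite_E by (meson finite_subset psubset_imp_subset)
  then show ?thesis using \<open>X \<subset> E\<close>
  proof (induction X rule: finite_psubset_induct)
    case (psubset X)
    obtain x where x: "x \<in> E" "x \<notin> X" using psubset.prems by auto
    have XE: "X \<subseteq> E" using psubset.prems by auto
    show ?case
    proof (cases "X = {}")
      case False
      then obtain a where a: "a \<in> X" by auto
      have IHa: "g (X - {a}) = (if even (card (X - {a})) then 1 else 0)"
        by (rule psubset.IH) (use psubset.prems a in auto)
      have cX: "card X = Suc (card (X - {a}))"
        using a psubset.hyps by (metis card.remove)
      show ?thesis
      proof (cases "even (card (X - {a}))")
        case True
        have "g X \<noteq> 1"
          using D_remove(2)[of X a] IHa True XE a by auto
        moreover have "g X \<in> {0, 1}" using proper_value XE x by blast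
        ultimately show ?thesis using cX True by auto
      next
        case odd: False
        then have "X - {a} \<noteq> {}" by (metis card.empty even_zero)
        then obtain b where b: "b \<in> X" "b \<noteq> a" by auto
        have "card (X - {a}) = Suc (card (X - {a, b}))"
          using b psubset.hyps card.remove[of "X - {a}" b] by (simp add: Diff_insert2[symmetric] insert_commute)
        then have "g (X - {a, b}) = 1"
          using psubset.IH[of "X - {a, b}"] psubset.prems a odd by auto
        moreover have "g {a, b} = 1" using pairs a b XE by auto
        ultimately have "g X = 1"
          using proper_closed[of "X - {a, b}" "{a, b}" x X] a b x XE by auto
        then show ?thesis using cX odd by simp
      qed
    qed (simp add: empty)
  qed
qed

section \<open>All complements of single elements have value 1\<close>

context
  assumes copoints: "\<And>e. e \<in> E \<Longrightarrow> g (E - {e}) = 1"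
begin

lemma D_copoint:
  assumes "e \<in> E" "b \<in> E" "e \<noteq> b"
  shows "g (E - {e, b}) = 0" "D e (E - {e, b}) = 1"
proof -
  have eq: "E - {b} - {e} = E - {e, b}" by auto
  show "g (E - {e, b}) = 0" "D e (E - {e, b}) = 1"
    using D_remove[of "E - {b}" e] copoints[of b] assms unfolding eq by auto
qed

lemma D_pair:
  assumes "e \<in> E" "b \<in> E" "c \<in> E" "e \<noteq> b" "e \<noteq> c" "b \<noteq> c"
  shows "D e {b, c} = 1"
  by (rule D_closed[of e "E - {e, b}" "E - {e, c}"]) (use D_copoint assms in auto)

text \<open>By \<open>D_pair\<close>, exactly one of \<open>{b, c}\<close> and
  \<open>{e, b, c}\<close> has value 1. Pairs turn out to have value 0 and triples value 1, and a
  fifth element would let two triples produce a pair of value 1.\<close>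

lemma negative_top:
  assumes top: "g E = -1"
  shows "card E = 4 \<and>
    (\<forall>X. X \<subseteq> E \<longrightarrow> g X = (if card X \<in> {1, 2} then 0 else if card X \<in> {0, 3} then 1 else -1))"
proof -
  have DE: "D e (E - {e}) = 0" if "e \<in> E" for e
    using that top copoints by (simp add: D_def insert_absorb)
  have c4: "card E \<ge> 4"
  proof (rule ccontr)
    assume "\<not> card E \<ge> 4"
    then have "card E = 3" using card_E by simp
    then obtain a b c where abc: "E = {a, b, c}" "a \<noteq> b" "a \<noteq> c" "b \<noteq> c"
      by (auto simp: card_3_iff)
    have "D a {b, c} = 1" using D_pair abc by auto
    moreover have "E - {a} = {b, c}" using abc by auto
    ultimately show False using DE[of a] abc by auto
  qed
  \<comment> \<open>The equations for \<open>D e {b, c}\<close> and \<open>D c {b, e}\<close> share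
    the triple \<open>{b, c, e}\<close>, so both pairs have the same value.\<close>
  have pair_step: "g {b, e} = 1"
    if "g {b, c} = 1" "b \<in> E" "c \<in> E" "e \<in> E" "b \<noteq> c" "b \<noteq> e" for b c e
  proof (cases "e = c")
    case False
    have "D e {b, c} = 1" "D c {b, e} = 1" using that False D_pair by auto
    then show ?thesis using that by (simp add: D_def insert_commute)
  qed (use that in simp)
  have pairs0: "g {b, c} = 0" if bc: "b \<in> E" "c \<in> E" "b \<noteq> c" for b c
  proof (rule ccontr)
    assume "g {b, c} \<noteq> 0"
    moreover have "{b, c} \<noteq> E" using c4 bc by auto
    ultimately have gbc: "g {b, c} = 1" using proper_value[of "{b, c}"] bc by blast
    \<comment> \<open>One pair of value 1 spreads to all pairs. Then \<open>g\<close> is parity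
      below the top, \<open>card E\<close> is odd, and adding \<open>{b, c}\<close> to
      \<open>E - {e, b, c}\<close> in the deletion of \<open>e\<close> contradicts
      \<open>DE\<close>.\<close>
    have pairs: "g {x, y} = 1" if "x \<in> E" "y \<in> E" "x \<noteq> y" for x y
      using pair_step gbc bc that by (metis insert_commute)
    note val = value_if_pairs[OF pairs, simplified]
    have "E - {b} \<subset> E" using bc by auto
    from val[OF this] copoints[OF bc(1)] have ev: "even (card (E - {b}))"
      by (auto split: if_splits)
    have "E \<noteq> {b, c}" using c4 bc by auto
    then obtain e where e: "e \<in> E" "e \<noteq> b" "e \<noteq> c" using bc by auto
    have cards: "card (E - {e, b, c}) = card E - 3" "card (E - {b, c}) = card E - 2"
      "card (E - {b}) = card E - 1"
      using e bc finite_E by (simp_all add: card_Diff_subset)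
    have ps: "E - {e, b, c} \<subset> E" "E - {b, c} \<subset> E" using e bc by auto
    have "g (E - {e, b, c}) = 1" "g (E - {b, c}) = 0"
      using val[OF ps(1)] val[OF ps(2)] ev c4 unfolding cards by auto
    moreover have "insert e (E - {e, b, c}) = E - {b, c}" using e by auto
    ultimately have "D e (E - {e, b, c}) = 1" by (simp add: D_def)
    moreover have "D e {b, c} = 1" using D_pair e bc by auto
    ultimately have "D e (E - {e}) = 1"
      by (rule D_closed) (use e bc in auto)
    then show False using DE e by simp
  qed
  have triples: "g {b, c, e} = 1"
    if "b \<in> E" "c \<in> E" "e \<in> E" "b \<noteq> c" "b \<noteq> e" "c \<noteq> e" for b c e
    using D_pair[of e b c] pairs0[of b c] that by (auto simp: D_def insert_commute)
  have "card E = 4"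
  proof (rule ccontr)
    assume "card E \<noteq> 4"
    then have "card E \<ge> 5" using c4 by simp
    then obtain S where S: "S \<subseteq> E" "card S = 5" by (meson obtain_subset_with_card_n)
    then obtain xs where xs: "set xs = S" "distinct xs"
      using finite_E finite_subset finite_distinct_list by metis
    then have "length xs = 5" using S distinct_card[of xs] by simp
    then obtain b c d e x where "xs = [b, c, d, e, x]"
      by (auto simp: length_Suc_conv numeral_eq_Suc)
    then have in_E: "{b, c, d, e, x} \<subseteq> E" and dist: "distinct [b, c, d, e, x]"
      using S xs by auto
    have "g {b, c, d} = 1" "g {b, c, e} = 1" using triples in_E dist by auto
    then have "g {d, e} = 1"
      by (rule proper_closed[where e = x]) (use in_E dist in auto)
    then show False using pairs0[of d e] in_E dist by auto
  qed
  moreover have "g X = (if card X \<in> {1, 2} then 0 else if card X \<in> {0, 3} then 1 else -1)"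
    if X: "X \<subseteq> E" for X
  proof -
    have fin: "finite X" using X finite_E finite_subset by blast
    have "card X \<le> 4" using card_mono[OF finite_E X] \<open>card E = 4\<close> by simp
    then consider "card X = 0" | "card X = 1" | "card X = 2" | "card X = 3" | "card X = 4"
      by linarith
    then show ?thesis
    proof cases
      case 1 then show ?thesis using fin empty by simp
    next
      case 2
      then show ?thesis using loopless X by (auto simp: card_1_singleton_iff)
    next
      case 3
      then obtain a b where "X = {a, b}" "a \<noteq> b" by (auto simp: card_2_iff)
      then show ?thesis using pairs0 X by auto
    next
      case 4
      then obtain a b c where "X = {a, b, c}" "a \<noteq> b" "a \<noteq> c" "b \<noteq> c" by (auto simp: card_3_iff)
      then show ?thesis using triples X 4 by auto
    next
      case 5
      then have "X = E" using card_subset_eq[OF finite_E X] \<open>card E = 4\<close> by simp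
      then show ?thesis using top 5 by simp
    qed
  qed
  ultimately show ?thesis by blast
qed

end

section \<open>Top value 0\<close>

text \<open>Adding \<open>X - {e}\<close> and \<open>Y\<close> in the deletion of \<open>e\<close>
  gives every \<open>E - {e}\<close> value 1, which forces all pairs to value 1. By parity
  \<open>card E\<close> is then even, being a sum of two even sizes, but also odd because of
  \<open>E - {e}\<close>.\<close>

lemma no_complementary_pair:
  assumes top: "g E = 0" and XY: "X \<union> Y = E" "X \<inter> Y = {}" "g X = 1" "g Y = 1"
  shows False
proof -
  have half: "g (E - {e}) = 1"
    if "e \<in> X" "X \<union> Y = E" "X \<inter> Y = {}" "g X = 1" "g Y = 1" for X Y e
  proof -
    have "X \<noteq> {e}" using that loopless by auto
    then obtain x where x: "x \<in> X" "x \<noteq> e" using \<open>e \<in> X\<close> by auto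
    have 1: "D e (X - {e}) = 1" by (rule D_remove) (use that in auto)
    have 2: "D e Y = 1" by (rule D_add[where x = x]) (use that x in auto)
    have "D e (E - {e}) = 1" by (rule D_closed[OF 1 2]) (use that in auto)
    moreover have "insert e (E - {e}) = E" using that by auto
    ultimately show ?thesis using top by (simp add: D_def)
  qed
  have cop: "g (E - {e}) = 1" if "e \<in> E" for e
    using half[of e X Y] half[of e Y X] that XY by auto
  have pairs: "g {a, b} = 1" if ab: "a \<in> E" "b \<in> E" "a \<noteq> b" for a b
  proof -
    \<comment> \<open>The two sets differ by \<open>{b}\<close>, and \<open>D a {b}\<close> is
      \<open>g {a, b}\<close> because \<open>g {b}\<close> is 0.\<close>
    have 1: "D a (E - {a, b}) = 1" using D_copoint(2) cop ab by blast
    have 2: "D a (E - {a}) = 1" using cop ab top by (simp add: D_def insert_absorb)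
    have "D a {b} = 1" by (rule D_closed[OF 1 2]) (use ab in auto)
    then show ?thesis using loopless ab by (simp add: D_def)
  qed
  note val = value_if_pairs[OF pairs, simplified]
  have ne: "X \<subset> E" "Y \<subset> E" using XY top by auto
  have ev: "even (card X)" "even (card Y)"
    using val[OF ne(1)] val[OF ne(2)] XY by (auto split: if_splits)
  have fin: "finite X" "finite Y" using XY finite_E by auto
  have "card E = card X + card Y" using card_Un_disjoint[OF fin XY(2)] XY(1) by simp
  then have evE: "even (card E)" using ev by simp
  obtain e where e: "e \<in> E" using ne by auto
  have ps: "E - {e} \<subset> E" using e by auto
  have "even (card (E - {e}))" using val[OF ps] cop[OF e] by (auto split: if_splits)
  then show False using evE e finite_E card_E by (simp add: card_Diff_singleton)
qed

text \<open>In the deletion of \<open>e\<close>, \<open>X - {e}\<close> and \<open>Y - {e}\<close>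
  add up to \<open>sym_diff X Y\<close>. The resulting 1 must come from the set containing
  \<open>e\<close>.\<close>

lemma common_point:
  assumes "X \<union> Y = E" "g X = 1" "g Y = 1" "g (sym_diff X Y) \<noteq> 1" "e \<in> X" "e \<in> Y"
  shows "g (insert e (sym_diff X Y)) = 1"
proof -
  have eE: "e \<in> E" using assms by auto
  have 1: "D e (X - {e}) = 1" by (rule D_remove) (use assms in auto)
  have 2: "D e (Y - {e}) = 1" by (rule D_remove) (use assms in auto)
  have "D e (sym_diff X Y) = 1" by (rule D_closed[OF 1 2]) (use assms eE in auto)
  moreover have "g (sym_diff X Y) \<in> {0, 1}"
    by (rule proper_value[where e = e]) (use assms eE in auto)
  ultimately show ?thesis using assms by (auto simp: D_def)
qed

text \<open>Induction on the overlap. Overlaps of size 0, 1 and 2 are contradictory; a larger one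
  shrinks by two elements \<open>e\<close>, \<open>d\<close> whose pair has value 1.\<close>

lemma closed_if_top_zero:
  assumes top: "g E = 0" and "X \<union> Y = E" "g X = 1" "g Y = 1"
  shows "g (sym_diff X Y) = 1"
  using assms(2-)
proof (induction "card (X \<inter> Y)" arbitrary: X rule: less_induct)
  case less
  note XY = less.prems
  show ?case
  proof (rule ccontr)
    assume nw: "g (sym_diff X Y) \<noteq> 1"
    note cp = common_point[OF XY nw]
    have sub: "X \<subset> E" "Y \<subset> E" using XY top by auto
    have "X \<inter> Y \<noteq> {}" using no_complementary_pair[OF top] XY by blast
    then obtain e where e: "e \<in> X" "e \<in> Y" by auto
    have "X \<inter> Y \<noteq> {e}"
    proof
      assume "X \<inter> Y = {e}"
      then have "insert e (sym_diff X Y) = E" using XY by auto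
      then show False using cp[OF e] top by simp
    qed
    then obtain d where d: "d \<in> X" "d \<in> Y" "d \<noteq> e" using e by auto
    have in_E: "e \<in> E" "d \<in> E" using e d XY by auto
    have fin: "finite X" "finite Y" using XY finite_E by auto
    obtain x where x: "x \<in> E" "x \<notin> Y" using sub by auto
    obtain y where y: "y \<in> E" "y \<notin> X" using sub by auto
    \<comment> \<open>Otherwise \<open>X - {e, d}\<close> and \<open>Y\<close> would be a
      complementary pair.\<close>
    have ed_impossible: "g {e, d} \<noteq> 1" if "X \<inter> Y = {e, d}"
    proof
      assume "g {e, d} = 1"
      with XY(2) have "g (X - {e, d}) = 1"
        by (rule proper_closed[where e = y]) (use y in_E e d XY in auto)
      then show False
        using no_complementary_pair[OF top, of "X - {e, d}" Y] XY that e d by auto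
    qed
    show False
    proof (cases "X \<inter> Y = {e, d}")
      case True
      have cop: "g (E - {d}) = 1"
      proof -
        have "insert e (sym_diff X Y) = E - {d}" using True XY d by auto
        then show ?thesis using cp[OF e] by simp
      qed
      have cop': "g (E - {e}) = 1"
      proof -
        have "insert d (sym_diff X Y) = E - {e}" using True XY d by auto
        then show ?thesis using cp[OF d(1,2)] by simp
      qed
      have comp0: "g (E - X) \<noteq> 1"
        using no_complementary_pair[OF top, of X "E - X"] XY by auto
      \<comment> \<open>\<open>E - {c}\<close> and \<open>X - {c}\<close> add up to
        \<open>E - X\<close> in the deletion of \<open>c\<close>. For \<open>c\<close> equal to
        \<open>e\<close> and \<open>d\<close>, the resulting sets differ by the forbidden pair
        \<open>{e, d}\<close>.\<close>
      have step: "g (insert c (E - X)) = 1" if c: "c \<in> X" "g (E - {c}) = 1" for c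
      proof -
        have cE: "c \<in> E" using c XY by auto
        have 1: "D c (E - {c}) = 1" using c cE top by (simp add: D_def insert_absorb)
        have 2: "D c (X - {c}) = 1" by (rule D_remove) (use c XY in auto)
        have "D c (E - X) = 1" by (rule D_closed[OF 1 2]) (use c cE XY in auto)
        moreover have "g (E - X) \<in> {0, 1}" by (rule proper_value[where e = c]) (use c cE in auto)
        ultimately show ?thesis using comp0 by (auto simp: D_def)
      qed
      have "g (insert e (E - X)) = 1" "g (insert d (E - X)) = 1"
        using step e d cop cop' by auto
      then have "g {e, d} = 1"
        by (rule proper_closed[where e = x]) (use x e d in_E XY in auto)
      then show False using ed_impossible True by blast
    next
      case False
      \<comment> \<open>A third common element stays outside the sets being added, so
        \<open>{e, d}\<close> gets value 1 and can be restored after the induction step.\<close>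
      then obtain z where z: "z \<in> X" "z \<in> Y" "z \<noteq> e" "z \<noteq> d" using e d by auto
      have zE: "z \<in> E" using z XY by auto
      have "g (insert e (sym_diff X Y)) = 1" "g (insert d (sym_diff X Y)) = 1"
        using cp e d by auto
      then have ged: "g {e, d} = 1"
        by (rule proper_closed[where e = z]) (use z zE e d in_E XY in auto)
      with XY(2) have gX: "g (X - {e, d}) = 1"
        by (rule proper_closed[where e = y]) (use y in_E e d XY in auto)
      have "(X - {e, d}) \<inter> Y \<subset> X \<inter> Y" using e by auto
      then have "card ((X - {e, d}) \<inter> Y) < card (X \<inter> Y)"
        using fin by (simp add: psubset_card_mono)
      moreover have "(X - {e, d}) \<union> Y = E" using XY e d by auto
      ultimately have "g (sym_diff (X - {e, d}) Y) = 1" using less.hyps gX XY(3) by blast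
      then have "g (sym_diff X Y) = 1" using ged
        by (rule proper_closed[where e = z]) (use z zE e d in_E XY in auto)
      then show False using nw by simp
    qed
  qed
qed

section \<open>Top value 1\<close>

text \<open>The same descent by two elements for the pair \<open>E\<close>, \<open>Y\<close>. It
  cannot stop at two elements, because \<open>insert e (E - Y)\<close> would be some
  \<open>E - {d}\<close>, which has value 0 by \<open>D_remove\<close>.\<close>

lemma complement_closed_if_top_one:
  assumes top: "g E = 1" and "Y \<subseteq> E" "g Y = 1"
  shows "g (E - Y) = 1"
  using assms(2-)
proof (induction "card Y" arbitrary: Y rule: less_induct)
  case less
  note Y = less.prems
  have cop: "g (E - {e}) = 0" if "e \<in> E" for e
    using D_remove(2)[of E e] top that by simp
  show ?case
  proof (rule ccontr)
    assume nw: "g (E - Y) \<noteq> 1"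
    have un: "E \<union> Y = E" and sd: "sym_diff E Y = E - Y" using Y by auto
    have step: "g (insert e (E - Y)) = 1" if "e \<in> Y" for e
      using common_point[OF un top Y(2)] nw that Y unfolding sd by auto
    have "Y \<noteq> {}" using nw top by auto
    then obtain e where e: "e \<in> Y" by auto
    have "Y \<noteq> {e}" using loopless[of e] Y by auto
    then obtain d where d: "d \<in> Y" "d \<noteq> e" using e by auto
    have "Y \<noteq> {e, d}"
    proof
      assume "Y = {e, d}"
      then have "insert e (E - Y) = E - {d}" using Y d by auto
      then show False using step[OF e] cop[of d] d Y by auto
    qed
    then obtain z where z: "z \<in> Y" "z \<noteq> e" "z \<noteq> d" using e d by auto
    have in_E: "e \<in> E" "d \<in> E" "z \<in> E" using e d z Y by auto
    from step[OF e] step[OF d(1)] have ged: "g {e, d} = 1"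
      by (rule proper_closed[where e = z]) (use z e d in_E in auto)
    have "Y \<noteq> E"  using nw empty by auto
    then obtain y where y: "y \<in> E" "y \<notin> Y" using Y by auto
    from Y(2) ged have gY: "g (Y - {e, d}) = 1"
      by (rule proper_closed[where e = y]) (use y e d Y in auto)
    have "card (Y - {e, d}) < card Y"
      using e Y finite_E finite_subset by (intro psubset_card_mono) auto
    then have "g (E - (Y - {e, d})) = 1" using less.hyps gY Y by blast
    then have "g (E - Y) = 1" using ged
      by (rule proper_closed[where e = z]) (use z e d in_E in auto)
    then show False using nw by simp
  qed
qed

section \<open>Classification of the nonlinear cases\<close>

lemma nonlinear_imp_uniform:
  assumes "\<not> linear_bf E g"
  shows "card E = 4 \<and>
    (\<forall>X. X \<subseteq> E \<longrightarrow> g X = (if card X \<in> {1, 2} then 0 else if card X \<in> {0, 3} then 1 else -1))"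
proof (cases "g E \<in> {0, 1}")
  case True
  obtain X Y where XY: "X \<union> Y = E" "g X = 1" "g Y = 1" "g (sym_diff X Y) \<noteq> 1"
    using nonlinear_witness[OF assms True] by blast
  from True have top: "g E = 1" using closed_if_top_zero XY by auto
  have "g (E - X) = 1" "g (E - Y) = 1" using complement_closed_if_top_one[OF top] XY by auto
  note compl = this
  have "X \<inter> Y \<noteq> {}"
  proof
    assume "X \<inter> Y = {}"
    then have "sym_diff X Y = E" using XY by auto
    then show False using XY top by simp
  qed
  then obtain e where "e \<in> X" "e \<in> Y" by auto
  \<comment> \<open>The complements of \<open>X\<close> and \<open>Y\<close> have the same symmetric
    difference and both miss \<open>e\<close>.\<close>
  then have "g (sym_diff X Y) = 1"
    by (intro proper_closed[OF compl, of e]) (use XY in auto)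
  then show ?thesis using XY by simp
next
  case False
  \<comment> \<open>With \<open>g E\<close> outside {0, 1}, only \<open>g E = -1\<close> and
    \<open>g (E - {e}) = 1\<close> satisfy this.\<close>
  have vals: "g (E - {e}) \<in> {0, 1} \<and> g (E - {e}) + g E \<in> {0, 1}" if "e \<in> E" for e
    using D_value[of e "E - {e}"] proper_value[of "E - {e}" e] that
    by (auto simp: D_def insert_absorb)
  obtain e where e: "e \<in> E" using card_E by fastforce
  have top: "g E = -1" using vals[OF e] False by auto
  have "g (E - {e}) = 1" if "e \<in> E" for e using vals[OF that] top by auto
  then show ?thesis using negative_top top by blast
qed

end

lemma (in almost_linear) nonlinear_cases:
  assumes nonlin: "\<not> linear_bf E g"
  obtains (single) a where "E = {a}" "g {a} \<notin> {0, 1}"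
  | (double) "card E = 2" "\<And>X. X \<subseteq> E \<Longrightarrow> g X = (if card X \<in> {0, 1} then 1 else -1)"
  | (quad) "card E = 4"
    "\<And>X. X \<subseteq> E \<Longrightarrow> g X = (if card X \<in> {1, 2} then 0 else if card X \<in> {0, 3} then 1 else -1)"
proof -
  consider "card E = 0" | "card E = 1" | "card E = 2" | "card E \<ge> 3" by linarith
  then show ?thesis
  proof cases
    case 1
    then have "E = {}" using finite_E by simp
    then have "linear_bf E g" using empty by (auto simp: linear_bf_def)
    then show ?thesis using nonlin by simp
  next
    case 2
    then obtain a where a: "E = {a}" by (auto simp: card_1_singleton_iff)
    have "g {a} \<notin> {0, 1}"
    proof
      assume "g {a} \<in> {0, 1}"
      then have "linear_bf E g" using empty a by (auto simp: linear_bf_def subset_singleton_iff)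
      then show False using nonlin by simp
    qed
    then show ?thesis using single a by blast
  next
    case 3
    then obtain a b where ab: "E = {a, b}" "a \<noteq> b" by (auto simp: card_2_iff)
    have subs: "X = {} \<or> X = {a} \<or> X = {b} \<or> X = {a, b}" if "X \<subseteq> E" for X
      using that ab by auto
    have p: "g {a} \<in> {0, 1}" "g {b} \<in> {0, 1}"
      using proper_value[of "{a}" b] proper_value[of "{b}" a] ab by auto
    have "linear_bf (E - {a}) (\<lambda>V. (g V + g (insert a V)) / (1 + g {a}))"
      "linear_bf (E - {b}) (\<lambda>V. (g V + g (insert b V)) / (1 + g {b}))"
      by (rule delete; use p ab in auto)+
    then have q: "(g {b} + g {a, b}) / (1 + g {a}) \<in> {0, 1}"
      "(g {a} + g {a, b}) / (1 + g {b}) \<in> {0, 1}"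
      using ab unfolding linear_bf_def by (auto simp: insert_commute)
    have "g {a} = 1 \<and> g {b} = 1 \<and> g {a, b} = -1"
    proof (rule ccontr)
      assume neg: "\<not> ?thesis"
      have top: "g {a, b} \<in> {0, 1}" using p q neg by (auto simp: field_simps)
      then have "g E \<in> {0, 1}" using ab by simp
      then obtain X Y where XY: "X \<union> Y = E" "g X = 1" "g Y = 1" "g (sym_diff X Y) \<noteq> 1"
        using nonlinear_witness[OF nonlin] by blast
      have sd: "{a, b} - {a} = {b}" "{a, b} - {b} = {a}" "{a} - {b} = {a}" "{b} - {a} = {b}"
        "{a} - {a, b} = {}" "{b} - {a, b} = {}" using ab by auto
      have "X \<subseteq> E" "Y \<subseteq> E" using XY by auto
      then have dis: "X = {} \<or> X = {a} \<or> X = {b} \<or> X = {a, b}"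
        "Y = {} \<or> Y = {a} \<or> Y = {b} \<or> Y = {a, b}" using subs by auto
      \<comment> \<open>Checking the four choices of \<open>g {a}\<close> and \<open>g {b}\<close>
        against \<open>q\<close>: apart from the excluded function, an element of value 1 can be
        added freely.\<close>
      have h: "g {a} = 1 \<Longrightarrow> g {b} = g {a, b}" "g {b} = 1 \<Longrightarrow> g {a} = g {a, b}"
        using p q neg by (auto simp: field_simps)
      show False
        using dis XY h empty sd ab by (elim disjE) auto
    qed
    then have "g X = (if card X \<in> {0, 1} then 1 else -1)" if "X \<subseteq> E" for X
      using subs[OF that] ab empty by auto
    then show ?thesis using double 3 by blast
  next
    case 4
    have "g {e} = 0" if "e \<in> E" for e
    proof -
      have "E \<noteq> {e}" using 4 by auto
      then have "g {e} \<in> {0, 1}" using proper_value[of "{e}"] that by blast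
      then show ?thesis using loop_imp_linear that 4 nonlin by blast
    qed
    then interpret loopless_almost_linear E g
      by unfold_locales (use 4 in auto)
    show ?thesis using nonlinear_imp_uniform[OF nonlin] quad by blast
  qed
qed

section \<open>Passage to minors and the characterization\<close>

lemma bf_isomorphic_by_card:
  assumes "finite E" "finite E'" "card E = card E'"
    and "\<And>X. X \<subseteq> E \<Longrightarrow> f X = h (card X)" "\<And>X. f' X = h (card X)"
  shows "bf_isomorphic E f E' f'"
proof -
  obtain \<phi> where \<phi>: "bij_betw \<phi> E E'" using finite_same_card_bij[OF assms(1-3)] by blast
  have "card (\<phi> ` X) = card X" if "X \<subseteq> E" for X
    using \<phi> that by (meson bij_betw_imp_inj_on card_image inj_on_subset)
  then show ?thesis unfolding bf_isomorphic_def using \<phi> assms by auto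
qed

theorem theorem9:
  fixes E :: "'a set" and f :: "'a set \<Rightarrow> real"
  assumes "binary_function E f"
  shows "linear_bf E f \<longleftrightarrow>
    \<not> (\<exists>E' f'. is_minor E' f' E f \<and>
        ((\<exists>\<alpha>. \<alpha> \<notin> {0, 1} \<and> bf_isomorphic E' f' {0} (f_alpha \<alpha>)) \<or>
         bf_isomorphic E' f' {0, 1} g_fun \<or>
         bf_isomorphic E' f' {0, 1, 2, 3} f_U24))"
  (is "_ \<longleftrightarrow> \<not> (\<exists>E' f'. is_minor E' f' E f \<and> ?bad E' f')")
proof
  assume lin: "linear_bf E f"
  show "\<not> (\<exists>E' f'. is_minor E' f' E f \<and> ?bad E' f')"
  proof
    assume "\<exists>E' f'. is_minor E' f' E f \<and> ?bad E' f'"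
    then obtain E' f' where minor: "is_minor E' f' E f" and bad: "?bad E' f'" by blast
    from minor obtain X Y where XY: "X \<subseteq> E" "Y \<subseteq> E" "X \<inter> Y = {}"
      "(\<Sum>Z\<in>Pow Y. contraction E f X Z) \<noteq> 0" "E' = E - X - Y"
      "f' = deletion (E - X) (contraction E f X) Y"
      unfolding is_minor_def deletion_defined_def by blast
    \<comment> \<open>Isomorphisms match full ground sets, so it suffices to compare values there:
      \<alpha>, -1 and -1 for the excluded functions.\<close>
    have s1: "(\<Sum>Z\<in>Pow Y. contraction E f X Z) = (\<Sum>Z\<in>Pow Y. f Z)"
      by (rule sum.cong) (use XY in \<open>auto simp: contraction_def\<close>)
    have s2: "(\<Sum>Z\<in>Pow Y. contraction E f X (E' \<union> Z)) = (\<Sum>Z\<in>Pow Y. f (E' \<union> Z))"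
      by (rule sum.cong) (use XY in \<open>auto simp: contraction_def\<close>)
    have "f' E' = (\<Sum>Z\<in>Pow Y. f (E' \<union> Z)) / (\<Sum>Z\<in>Pow Y. f Z)"
      using XY s1 s2 by (simp add: deletion_def)
    moreover have "(\<Sum>Z\<in>Pow Y. f (E' \<union> Z)) / (\<Sum>Z\<in>Pow Y. f Z) \<in> {0, 1}"
      by (rule linear_bf_deletion_value[OF lin])
        (use assms XY s1 in \<open>auto simp: binary_function_def\<close>)
    ultimately have "f' E' \<in> {0, 1}" by simp
    moreover have iso: "f' E' = h E''" if "bf_isomorphic E' f' E'' h" for E'' :: "nat set" and h
      using that unfolding bf_isomorphic_def bij_betw_def by auto
    ultimately show False using bad by (auto dest!: iso simp: f_alpha_def g_fun_def f_U24_def)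
  qed
next
  assume no_bad: "\<not> (\<exists>E' f'. is_minor E' f' E f \<and> ?bad E' f')"
  have fin: "finite E" and f0: "f {} = 1" using assms by (auto simp: binary_function_def)
  \<comment> \<open>Unnormalized deletion of \<open>Y\<close>.\<close>
  define s where "s Y V = (\<Sum>Z\<in>Pow Y. f (V \<union> Z))" for Y V
  have s_insert: "s (insert e Y) V = s Y V + s Y (insert e V)" if "e \<notin> Y" "finite Y" for e Y V
  proof -
    have "inj_on (insert e) (Pow Y)" using that by (auto simp: inj_on_def)
    moreover have "Pow Y \<inter> insert e ` Pow Y = {}" using that by auto
    ultimately show ?thesis
      using that by (simp add: s_def Pow_insert sum.union_disjoint sum.reindex)
  qed
  \<comment> \<open>Every minor is covered at once: ground set \<open>W\<close>, deleted set
    \<open>Y\<close>, all other elements contracted. Contracting \<open>e\<close> shrinks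
    \<open>W\<close>; deleting \<open>e\<close> moves it to \<open>Y\<close>. Induction on
    \<open>card W\<close> replaces the choice of a minimal minor.\<close>
  have main: "linear_bf W (\<lambda>V. s Y V / s Y {})"
    if "W \<subseteq> E" "Y \<subseteq> E" "W \<inter> Y = {}" "s Y {} \<noteq> 0" for W Y
    using that
  proof (induction "card W" arbitrary: W Y rule: less_induct)
    case less
    note WY = less.prems
    define g where "g V = s Y V / s Y {}" for V
    have finW: "finite W" "finite Y" using WY fin by (auto intro: finite_subset)
    have smaller: "card (W - {e}) < card W" if "e \<in> W" for e
      using card_Diff1_less[OF finW(1) that] .
    have g0: "g {} = 1" using WY by (simp add: g_def)
    interpret almost_linear W g
    proof
      show "finite W" by fact
      show "g {} = 1" by fact
    next
      fix e assume e: "e \<in> W"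
      show "linear_bf (W - {e}) g"
        unfolding g_def by (rule less.hyps[OF smaller[OF e]]) (use WY in auto)
      assume ge: "g {e} \<noteq> -1"
      have eY: "e \<notin> Y" using e WY by auto
      \<comment> \<open>The common factor \<open>s Y {}\<close> cancels, so iterated deletion is
        deletion of \<open>insert e Y\<close>.\<close>
      have denom: "s (insert e Y) {} = s Y {} * (1 + g {e})"
        using s_insert[OF eY finW(2), of "{}"] WY by (simp add: g_def field_simps)
      have num: "s (insert e Y) V = s Y {} * (g V + g (insert e V))" for V
        using s_insert[OF eY finW(2), of V] WY by (simp add: g_def field_simps)
      have "1 + g {e} \<noteq> 0" using ge by linarith
      then have "s (insert e Y) {} \<noteq> 0" using denom WY by simp
      then have "linear_bf (W - {e}) (\<lambda>V. s (insert e Y) V / s (insert e Y) {})"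
        by (intro less.hyps[OF smaller[OF e]]) (use WY e in auto)
      then show "linear_bf (W - {e}) (\<lambda>V. (g V + g (insert e V)) / (1 + g {e}))"
        unfolding denom num using WY g0 by simp
    qed
    define X where "X = E - W - Y"
    define f' where "f' = deletion (E - X) (contraction E f X) Y"
    have EX: "E - X = W \<union> Y" using WY X_def by auto
    have s1: "(\<Sum>Z\<in>Pow Y. contraction E f X Z) = s Y {}"
      unfolding s_def by (rule sum.cong) (auto simp: contraction_def EX)
    have s2: "(\<Sum>Z\<in>Pow Y. contraction E f X (V \<union> Z)) = s Y V" if "V \<subseteq> W" for V
      unfolding s_def by (rule sum.cong) (use that in \<open>auto simp: contraction_def EX\<close>)
    have f'_eq: "f' V = g V" if V: "V \<subseteq> W" for V
    proof -
      have "V \<in> Pow (E - X - Y)" using V WY EX by auto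
      then show ?thesis using s1 s2[OF V] by (simp add: f'_def deletion_def g_def)
    qed
    have "is_minor W f' E f"
      unfolding is_minor_def deletion_defined_def
      by (rule exI[of _ X], rule exI[of _ Y])
        (use WY s1 EX in \<open>auto simp: f'_def X_def\<close>)
    then have good: "\<not> ?bad W f'" using no_bad by blast
    show ?case
    proof (rule ccontr)
      assume "\<not> ?case"
      then have "\<not> linear_bf W g" by (simp add: g_def[abs_def])
      then show False
      proof (cases rule: nonlinear_cases)
        case (single a)
        have "bf_isomorphic W f' {0} (f_alpha (g {a}))"
          unfolding bf_isomorphic_def
          by (rule exI[of _ "\<lambda>_. 0"])
            (use single f'_eq empty in \<open>auto simp: f_alpha_def subset_singleton_iff bij_betw_def\<close>)
        then show False using good single by blast
      next
        case double
        have "bf_isomorphic W f' {0, 1} g_fun"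
          by (rule bf_isomorphic_by_card[where h = "\<lambda>n. if n \<in> {0, 1} then 1 else -1"])
            (use double finW f'_eq in \<open>auto simp: g_fun_def\<close>)
        then show False using good by blast
      next
        case quad
        have "bf_isomorphic W f' {0, 1, 2, 3} f_U24"
          by (rule bf_isomorphic_by_card[where
                h = "\<lambda>n. if n \<in> {1, 2} then 0 else if n \<in> {0, 3} then 1 else -1"])
            (use quad finW f'_eq in \<open>auto simp: f_U24_def\<close>)
        then show False using good by blast
      qed
    qed
  qed
  \<comment> \<open>Nothing deleted and nothing contracted: the minor is \<open>f\<close>
    itself.\<close>
  have "linear_bf E (\<lambda>V. s {} V / s {} {})" by (rule main) (auto simp: s_def f0)
  then show "linear_bf E f" by (rule linear_bf_cong) (simp add: s_def f0)
qed

end
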